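(* Let $\hat{\mathbf s}\in\Omega_1$ be any set of first-stage decisions. Then the inner-level procedure (the Inner-loop Algorithm described in the context) applied to $\hat{\mathbf s}$ exhibits finite convergence, i.e. it reaches $UB^{\rm inner}=LB^{\rm inner}$ after finitely many iterations, and the number of iterations is bounded by $\mathcal R$, where $\mathcal R$ is the total number of discrete points in the set $\Xi$ of possible values of the binary variables $(\mathbf q,\mathbf z)$.
   Context: **Data.** Finite index sets: $\mathcal I$ (access points, index $i$), $\mathcal J$ (edge nodes, indices $j,m$), $\mathcal T=\{1,\dots,T\}$ (time periods, index $t$). The index $0$ denotes the cloud. Given nonnegative parameters: slot length $\delta>0$; reserved prices $p_j^t,p_0^t$; buy-more prices $e_j^t,e_0^t$; sell-back prices $a_j^t,a_0^t$, with $e_j^t\ge p_j^t\ge a_j^t$ and $e_0^t\ge p_0^t\ge a_0^t$; installation costs $f_j^t$; storage costs $f_{j,t}^{\sf s}$; download costs $h_{m,j}^t$ (edge node $m$ to edge node $j$) and $h_{0,j}^t$ (cloud to $j$); capacities $C_j$; resource per request $w$; initial placement $z_j^0\in\{0,1\}$; workload costs $c_{i,j}=\rho d_{i,j}+\beta b H_{i,j}$ and $c_{i,0}=\rho d_{i,0}+\beta b H_{i,0}$, where $\rho$ is the delay penalty, $d$ the network delay, $\beta$ the unit bandwidth price, $b$ the request data size and $H$ the number of network hops. **First stage.** $\mathbf s=(s_j^t,s_0^t)$ belongs to $\Omega_1$ if $s_0^t\ge 0$ and $0\le s_j^t\le C_j$ for all $j,t$. **Uncertainty set.** $\mathcal D_2$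 is the set of demand vectors $\lambda=(\lambda_i^t)_{i,t}$ for which there are $g_i^t\in[-1,1]$ with $\sum_{i}|g_i^t|\le\Gamma_1$ for all $t$, such that $\lambda_i^t=\bar\lambda_i^t+\tilde\lambda_i^t$ and $\tilde\lambda_i^t=\sum_{s=1}^{L}A_i^s\tilde\lambda_i^{t-s}+B_i g_i^t$ for all $i,t$. Here the forecasts $\bar\lambda_i^t$, the coefficients $A_i^s,B_i$, the lag $L$, the integer budget $\Gamma_1$, and the past residuals $\tilde\lambda_i^{t}$ for $t\le 0$ are given. **Second stage.** The variables are $\mathbf q=(q_{m,j}^t\ (m\ne j),\,q_{0,j}^t)$ and $\mathbf z=(z_j^t)$, all binary (download and placement), and the continuous nonnegative variables $\mathbf x=(x_{i,j}^t,x_{i,0}^t)$ (workload) and $\mathbf y=(y_{j,t}^B,y_{0,t}^B,y_{j,t}^S,y_{0,t}^S)$ (buy-more and sell-back amounts). The feasible set $\Omega_2(\mathbf s,\lambda)$ consists of all $(\mathbf q,\mathbf z,\mathbf x,\mathbf y)$ such that, for all $i,j,m,t$ as applicable: - $x_{i,0}^t+\sum_j x_{i,j}^t\ge\lambda_i^t$; - $s_j^t+y_{j,t}^B-y_{j,t}^S\le C_j z_j^t$, $\;y_{j,t}^S\le s_j^t$, $\;y_{0,t}^S\le s_0^t$; - $s_0^t+y_{0,t}^B-y_{0,t}^S\ge w\sum_i x_{i,0}^t$, $\;s_j^t+y_{j,t}^B-y_{j,t}^S\ge w\sum_i x_{i,j}^t$; - $\sum_{j\neq m}q_{m,j}^t\le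 z_m^{t-1}$, $\;\sum_{m\neq j}q_{m,j}^t+q_{0,j}^t\ge z_j^t-z_j^{t-1}$. The second-stage cost is $F(\mathbf q,\mathbf z,\mathbf x,\mathbf y)=G(\mathbf q,\mathbf z)+H(\mathbf x,\mathbf y)$, where $$G=\sum_{j,t}\sum_{m\ne j}h_{m,j}^tq_{m,j}^t+\sum_{j,t}h_{0,j}^tq_{0,j}^t+\sum_{j,t}\big(f_j^t(1-z_j^{t-1})+f_{j,t}^{\sf s}\big)z_j^t,$$ $$H=\sum_{j,t}\delta\,[e_j^ty_{j,t}^B-a_j^ty_{j,t}^S]+\sum_t\delta\,[e_0^ty_{0,t}^B-a_0^ty_{0,t}^S]+\sum_{i,t}c_{i,0}x_{i,0}^t+\sum_{i,j,t}c_{i,j}x_{i,j}^t .$$ **Inner (max-min) problem.** For fixed $\hat{\mathbf s}$: $Q(\hat{\mathbf s})=\max_{\lambda\in\mathcal D_2}\ \min_{(\mathbf q,\mathbf z,\mathbf x,\mathbf y)\in\Omega_2(\hat{\mathbf s},\lambda)}F(\mathbf q,\mathbf z,\mathbf x,\mathbf y)$. Let $\Xi$ be the finite set of all possible values of the binary vectors $(\mathbf q,\mathbf z)$, and $\mathcal R=|\Xi|$. **Inner-loop Algorithm.** Input $\hat{\mathbf s}$ and an initial scenario $\lambda_0\in\mathcal D_2$. Set $LB^{\rm inner}=-\infty$, $UB^{\rm inner}=+\infty$, $r=0$. Each iteration does the following. 1. (Inner-SP) Compute an optimal solution $(\mathbf q^{r+1},\mathbf z^{r+1},\mathbf x^{r+1},\mathbf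 y^{r+1})$ of $\min\{F:(\mathbf q,\mathbf z,\mathbf x,\mathbf y)\in\Omega_2(\hat{\mathbf s},\lambda_r)\}$, and replace $LB^{\rm inner}$ by the maximum of its current value and this optimal value. 2. (Inner-MP) Compute an optimal solution $(\lambda_{r+1},\tau^* )$ of $$\max_{\lambda\in\mathcal D_2,\ \tau}\ \tau\quad\text{s.t.}\quad \tau\le G(\mathbf q^{n},\mathbf z^{n})+\min_{\mathbf x,\mathbf y}\{H(\mathbf x,\mathbf y):(\mathbf q^{n},\mathbf z^{n},\mathbf x,\mathbf y)\in\Omega_2(\hat{\mathbf s},\lambda)\},\quad n=1,\dots,r+1,$$ where the inner linear program is replaced by its dual via strong duality in the implementation. Set $UB^{\rm inner}=\tau^*$. 3. Set $r\leftarrow r+1$. The iterations are repeated until convergence, meaning $UB^{\rm inner}=LB^{\rm inner}$. *)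

theory Defs
  imports "HOL-Analysis.Analysis"
begin

text \<open>
  Access points are the elements of a finite type \<open>'i\<close>, edge nodes those of a finite type \<open>'j\<close>
  (in particular there is at least one of each), time periods are \<open>1, \<dots>, T\<close>.
  Quantities attached to the cloud (index 0) carry the suffix \<open>0\<close>.
  Superscripts and subscripts become arguments in the order access point, node(s), time;
  for a download from \<open>m\<close> to \<open>j\<close> the order is \<open>m j t\<close>.
\<close>

record ('i, 'j) edge_data =
  horizon :: nat                            \<comment> \<open>\<open>T\<close>\<close>
  slot :: real                              \<comment> \<open>\<open>\<delta>\<close>\<close>
  resv :: "'j \<Rightarrow> nat \<Rightarrow> real"               \<comment> \<open>\<open>p\<close>\<close>
  resv0 :: "nat \<Rightarrow> real"
  buy :: "'j \<Rightarrow> nat \<Rightarrow> real"                \<comment> \<open>\<open>e\<close>\<close>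
  buy0 :: "nat \<Rightarrow> real"
  sell :: "'j \<Rightarrow> nat \<Rightarrow> real"               \<comment> \<open>\<open>a\<close>\<close>
  sell0 :: "nat \<Rightarrow> real"
  inst_cost :: "'j \<Rightarrow> nat \<Rightarrow> real"          \<comment> \<open>\<open>f\<close>\<close>
  stor_cost :: "'j \<Rightarrow> nat \<Rightarrow> real"          \<comment> \<open>\<open>f\<^sup>s\<close>\<close>
  dl_cost :: "'j \<Rightarrow> 'j \<Rightarrow> nat \<Rightarrow> real"      \<comment> \<open>\<open>h\<close>\<close>
  dl_cost0 :: "'j \<Rightarrow> nat \<Rightarrow> real"
  capacity :: "'j \<Rightarrow> real"                  \<comment> \<open>\<open>C\<close>\<close>
  req_res :: real                           \<comment> \<open>\<open>w\<close>\<close>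
  init_place :: "'j \<Rightarrow> real"                \<comment> \<open>\<open>z\<^sup>0\<close>\<close>
  delay_pen :: real                         \<comment> \<open>\<open>\<rho>\<close>\<close>
  delay :: "'i \<Rightarrow> 'j \<Rightarrow> real"               \<comment> \<open>\<open>d\<close>\<close>
  delay0 :: "'i \<Rightarrow> real"
  bw_price :: real                          \<comment> \<open>\<open>\<beta>\<close>\<close>
  req_size :: real                          \<comment> \<open>\<open>b\<close>\<close>
  hops :: "'i \<Rightarrow> 'j \<Rightarrow> nat"                 \<comment> \<open>\<open>H\<close>\<close>
  hops0 :: "'i \<Rightarrow> nat"
  forecast :: "'i \<Rightarrow> nat \<Rightarrow> real"           \<comment> \<open>forecast demand\<close>
  ar_coeff :: "'i \<Rightarrow> nat \<Rightarrow> real"           \<comment> \<open>\<open>A\<close>\<close>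
  ar_noise :: "'i \<Rightarrow> real"                  \<comment> \<open>\<open>B\<close>\<close>
  lag :: nat                                \<comment> \<open>\<open>L\<close>\<close>
  budget :: int                             \<comment> \<open>\<open>\<Gamma>\<^sub>1\<close>\<close>
  past_resid :: "'i \<Rightarrow> int \<Rightarrow> real"         \<comment> \<open>residuals at times \<open>\<le> 0\<close>\<close>

definition work_cost :: "('i, 'j) edge_data \<Rightarrow> 'i \<Rightarrow> 'j \<Rightarrow> real" where
  "work_cost M i j = delay_pen M * delay M i j + bw_price M * req_size M * real (hops M i j)"

definition work_cost0 :: "('i, 'j) edge_data \<Rightarrow> 'i \<Rightarrow> real" where
  "work_cost0 M i = delay_pen M * delay0 M i + bw_price M * req_size M * real (hops0 M i)"

definition valid_data :: "('i, 'j) edge_data \<Rightarrow> bool" where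
  "valid_data M \<longleftrightarrow>
     slot M > 0 \<and> req_res M \<ge> 0 \<and>
     delay_pen M \<ge> 0 \<and> bw_price M \<ge> 0 \<and> req_size M \<ge> 0 \<and>
     (\<forall>i. delay0 M i \<ge> 0 \<and> (\<forall>j. delay M i j \<ge> 0)) \<and>
     (\<forall>j. capacity M j \<ge> 0 \<and> init_place M j \<in> {0, 1}) \<and>
     (\<forall>t\<in>{1..horizon M}.
        buy0 M t \<ge> resv0 M t \<and> resv0 M t \<ge> sell0 M t \<and> sell0 M t \<ge> 0 \<and>
        (\<forall>j. buy M j t \<ge> resv M j t \<and> resv M j t \<ge> sell M j t \<and> sell M j t \<ge> 0 \<and>
             inst_cost M j t \<ge> 0 \<and> stor_cost M j t \<ge> 0 \<and> dl_cost0 M j t \<ge> 0 \<and>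
             (\<forall>m. m \<noteq> j \<longrightarrow> dl_cost M m j t \<ge> 0)))"

text \<open>First-stage decisions are pairs (edge reservations, cloud reservations).\<close>

type_synonym 'j first_stage = "('j \<Rightarrow> nat \<Rightarrow> real) \<times> (nat \<Rightarrow> real)"

definition Omega1 :: "('i, 'j) edge_data \<Rightarrow> 'j first_stage set" where
  "Omega1 M = {(s, s0). \<forall>t\<in>{1..horizon M}. s0 t \<ge> 0 \<and> (\<forall>j. 0 \<le> s j t \<and> s j t \<le> capacity M j)}"

type_synonym 'i demand = "'i \<Rightarrow> nat \<Rightarrow> real"

text \<open>The residuals are indexed by integer times, since the recursion reaches back to times
  \<open>t - s \<le> 0\<close>, where they are given data.\<close>

definition D2 :: "('i::finite, 'j) edge_data \<Rightarrow> 'i demand set" where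
  "D2 M = {lam. \<exists>(g :: 'i \<Rightarrow> nat \<Rightarrow> real) (resid :: 'i \<Rightarrow> int \<Rightarrow> real).
     (\<forall>i. \<forall>t\<le>0. resid i t = past_resid M i t) \<and>
     (\<forall>t\<in>{1..horizon M}. (\<forall>i. g i t \<in> {-1..1}) \<and> (\<Sum>i\<in>UNIV. \<bar>g i t\<bar>) \<le> real_of_int (budget M)) \<and>
     (\<forall>i. \<forall>t\<in>{1..horizon M}.
        lam i t = forecast M i t + resid i (int t) \<and>
        resid i (int t) =
          (\<Sum>s=1..lag M. ar_coeff M i s * resid i (int t - int s)) + ar_noise M i * g i t)}"

record 'j placement =
  dl :: "'j \<Rightarrow> 'j \<Rightarrow> nat \<Rightarrow> real"             \<comment> \<open>\<open>q\<close>\<close>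
  dl0 :: "'j \<Rightarrow> nat \<Rightarrow> real"
  place :: "'j \<Rightarrow> nat \<Rightarrow> real"                \<comment> \<open>\<open>z\<close>\<close>

text \<open>All binary vectors \<open>(q, z)\<close>. Entries that are not components of the vectors
  (\<open>q\<close> with \<open>m = j\<close>, times outside \<open>1, \<dots>, T\<close>) are fixed to 0, so that the
  elements of \<open>Xi M\<close> correspond one-to-one to the binary vectors.\<close>

definition Xi :: "('i, 'j) edge_data \<Rightarrow> 'j placement set" where
  "Xi M = {d. \<forall>j t.
     (\<forall>m. dl d m j t \<in> {0, 1} \<and> (m = j \<or> t \<notin> {1..horizon M} \<longrightarrow> dl d m j t = 0)) \<and>
     dl0 d j t \<in> {0, 1} \<and> place d j t \<in> {0, 1} \<and>
     (t \<notin> {1..horizon M} \<longrightarrow> dl0 d j t = 0 \<and> place d j t = 0)}"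

definition prev_place :: "('i, 'j) edge_data \<Rightarrow> 'j placement \<Rightarrow> 'j \<Rightarrow> nat \<Rightarrow> real" where
  "prev_place M d j t = (if t = 1 then init_place M j else place d j (t - 1))"

record ('i, 'j) recourse =
  work :: "'i \<Rightarrow> 'j \<Rightarrow> nat \<Rightarrow> real"           \<comment> \<open>\<open>x\<close>\<close>
  work0 :: "'i \<Rightarrow> nat \<Rightarrow> real"
  buy_more :: "'j \<Rightarrow> nat \<Rightarrow> real"             \<comment> \<open>\<open>y\<^sup>B\<close>\<close>
  buy_more0 :: "nat \<Rightarrow> real"
  sell_back :: "'j \<Rightarrow> nat \<Rightarrow> real"            \<comment> \<open>\<open>y\<^sup>S\<close>\<close>
  sell_back0 :: "nat \<Rightarrow> real"

definition Omega2 ::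
  "('i::finite, 'j::finite) edge_data \<Rightarrow> 'j first_stage \<Rightarrow> 'i demand
     \<Rightarrow> ('j placement \<times> ('i, 'j) recourse) set" where
  "Omega2 M = (\<lambda>(s, s0) lam. {(d, c). d \<in> Xi M \<and>
     (\<forall>t\<in>{1..horizon M}.
        (\<forall>i. work0 c i t \<ge> 0 \<and> (\<forall>j. work c i j t \<ge> 0)) \<and>
        buy_more0 c t \<ge> 0 \<and> sell_back0 c t \<ge> 0 \<and> (\<forall>j. buy_more c j t \<ge> 0 \<and> sell_back c j t \<ge> 0) \<and>
        (\<forall>i. work0 c i t + (\<Sum>j\<in>UNIV. work c i j t) \<ge> lam i t) \<and>
        (\<forall>j. s j t + buy_more c j t - sell_back c j t \<le> capacity M j * place d j t) \<and>
        (\<forall>j. sell_back c j t \<le> s j t) \<and> sell_back0 c t \<le> s0 t \<and>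
        s0 t + buy_more0 c t - sell_back0 c t \<ge> req_res M * (\<Sum>i\<in>UNIV. work0 c i t) \<and>
        (\<forall>j. s j t + buy_more c j t - sell_back c j t \<ge> req_res M * (\<Sum>i\<in>UNIV. work c i j t)) \<and>
        (\<forall>m. (\<Sum>j\<in>UNIV - {m}. dl d m j t) \<le> prev_place M d m t) \<and>
        (\<forall>j. (\<Sum>m\<in>UNIV - {j}. dl d m j t) + dl0 d j t \<ge> place d j t - prev_place M d j t))})"

definition G_cost :: "('i, 'j::finite) edge_data \<Rightarrow> 'j placement \<Rightarrow> real" where
  "G_cost M d =
     (\<Sum>j\<in>UNIV. \<Sum>t=1..horizon M. \<Sum>m\<in>UNIV - {j}. dl_cost M m j t * dl d m j t) +
     (\<Sum>j\<in>UNIV. \<Sum>t=1..horizon M. dl_cost0 M j t * dl0 d j t) +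
     (\<Sum>j\<in>UNIV. \<Sum>t=1..horizon M.
        (inst_cost M j t * (1 - prev_place M d j t) + stor_cost M j t) * place d j t)"

definition H_cost :: "('i::finite, 'j::finite) edge_data \<Rightarrow> ('i, 'j) recourse \<Rightarrow> real" where
  "H_cost M c =
     (\<Sum>j\<in>UNIV. \<Sum>t=1..horizon M. slot M * (buy M j t * buy_more c j t - sell M j t * sell_back c j t)) +
     (\<Sum>t=1..horizon M. slot M * (buy0 M t * buy_more0 c t - sell0 M t * sell_back0 c t)) +
     (\<Sum>i\<in>UNIV. \<Sum>t=1..horizon M. work_cost0 M i * work0 c i t) +
     (\<Sum>i\<in>UNIV. \<Sum>j\<in>UNIV. \<Sum>t=1..horizon M. work_cost M i j * work c i j t)"

definition F_cost ::
  "('i::finite, 'j::finite) edge_data \<Rightarrow> 'j placement \<times> ('i, 'j) recourse \<Rightarrow> real" where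
  "F_cost M = (\<lambda>(d, c). G_cost M d + H_cost M c)"

definition inner_SP_optimal ::
  "('i::finite, 'j::finite) edge_data \<Rightarrow> 'j first_stage \<Rightarrow> 'i demand
     \<Rightarrow> 'j placement \<times> ('i, 'j) recourse \<Rightarrow> bool" where
  "inner_SP_optimal M s lam = is_arg_min (F_cost M) (\<lambda>p. p \<in> Omega2 M s lam)"

text \<open>Optimal value of the inner linear program for fixed \<open>(q, z)\<close>; extended reals give it
  the value \<open>\<infinity>\<close> if the linear program is infeasible.\<close>

definition recourse_value ::
  "('i::finite, 'j::finite) edge_data \<Rightarrow> 'j first_stage \<Rightarrow> 'j placement \<Rightarrow> 'i demand \<Rightarrow> ereal" where
  "recourse_value M s d lam = (INF c\<in>{c. (d, c) \<in> Omega2 M s lam}. ereal (H_cost M c))"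

definition inner_MP_feasible ::
  "('i::finite, 'j::finite) edge_data \<Rightarrow> 'j first_stage \<Rightarrow> 'j placement list
     \<Rightarrow> ('i demand \<times> real) set" where
  "inner_MP_feasible M s ds = {(lam, tau). lam \<in> D2 M \<and>
     (\<forall>d\<in>set ds. ereal tau \<le> ereal (G_cost M d) + recourse_value M s d lam)}"

definition inner_MP_optimal ::
  "('i::finite, 'j::finite) edge_data \<Rightarrow> 'j first_stage \<Rightarrow> 'j placement list
     \<Rightarrow> 'i demand \<times> real \<Rightarrow> bool" where
  "inner_MP_optimal M s ds = is_arg_max snd (\<lambda>p. p \<in> inner_MP_feasible M s ds)"

text \<open>State of the algorithm after \<open>r\<close> iterations: the two bounds, the scenario \<open>\<lambda>\<^sub>r\<close>
  and the list of the \<open>r\<close> binary solutions found so far.\<close>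

record ('i, 'j) inner_state =
  LB :: ereal
  UB :: ereal
  scen :: "'i demand"
  found :: "'j placement list"

definition inner_init :: "'i demand \<Rightarrow> ('i, 'j) inner_state" where
  "inner_init lam0 = \<lparr>LB = -\<infinity>, UB = \<infinity>, scen = lam0, found = []\<rparr>"

text \<open>One iteration, carried out only as long as the bounds differ. It is a relation because
  the choice of the optimal solutions is left open.\<close>

definition inner_step ::
  "('i::finite, 'j::finite) edge_data \<Rightarrow> 'j first_stage
     \<Rightarrow> ('i, 'j) inner_state \<Rightarrow> ('i, 'j) inner_state \<Rightarrow> bool" where
  "inner_step M s S S' \<longleftrightarrow> UB S \<noteq> LB S \<and>
     (\<exists>d c lam tau.
        inner_SP_optimal M s (scen S) (d, c) \<and>
        inner_MP_optimal M s (found S @ [d]) (lam, tau) \<and>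
        S' = \<lparr>LB = max (LB S) (ereal (F_cost M (d, c))), UB = ereal tau,
              scen = lam, found = found S @ [d]\<rparr>)"

end

theory Submission
  imports Defs
begin

text \<open>
  The upper bound is at most \<open>G(q, z)\<close> plus the recourse value of \<open>(q, z)\<close> at the current
  scenario, for every \<open>(q, z)\<close> found so far, so the gap closes as soon as one of them is found again.
  Counting alone gives the bound \<open>R + 1\<close>, since a last iteration is needed to see the repetition.
  The missing unit comes from placements with the same feasible recourse (twins): the gap also
  closes when a twin of an earlier solution is found, because both twins are then equally cheap,
  and \<open>\<Xi>\<close> always contains twins unless \<open>T = 0\<close>.

  That every iteration can be carried out needs the two optima to be attained. For the subproblem,
  unbounded recourse can be truncated to a compact box at no extra cost. For the master problem,
  the recourse value is continuous in the demand, since the cloud absorbs any change of demand at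
  proportional cost; so no linear programming duality is needed.
\<close>

section \<open>Recourse decisions\<close>

text \<open>Cost of serving the whole change of demand by extra cloud purchases and cloud workload.
  Taking the absolute value instead of the positive part makes it symmetric in the two demands, so
  that a one-sided estimate of the recourse value becomes two-sided.\<close>

definition adjustment_cost ::
  "('i::finite, 'j) edge_data \<Rightarrow> 'i demand \<Rightarrow> 'i demand \<Rightarrow> real" where
  "adjustment_cost M lam lam' =
     (\<Sum>t=1..horizon M. slot M * (buy0 M t * (req_res M * (\<Sum>i\<in>UNIV. \<bar>lam' i t - lam i t\<bar>)))) +
     (\<Sum>i\<in>UNIV. \<Sum>t=1..horizon M. work_cost0 M i * \<bar>lam' i t - lam i t\<bar>)"

lemma adjustment_cost_commute: "adjustment_cost M lam lam' = adjustment_cost M lam' lam"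
  by (simp add: adjustment_cost_def abs_minus_commute)

lemma adjustment_cost_eq_0:
  assumes "\<And>i t. t \<in> {1..horizon M} \<Longrightarrow> lam i t = lam' i t"
  shows "adjustment_cost M lam lam' = 0"
  using assms by (simp add: adjustment_cost_def)

lemma work_cost_nonneg: "valid_data M \<Longrightarrow> work_cost M i j \<ge> 0"
  by (simp add: valid_data_def work_cost_def)

lemma work_cost0_nonneg: "valid_data M \<Longrightarrow> work_cost0 M i \<ge> 0"
  by (simp add: valid_data_def work_cost0_def)

text \<open>A change of demand can always be absorbed by the cloud, whose workload and purchases are
  unbounded.\<close>

lemma Omega2_adjust:
  fixes M :: "('i::finite, 'j::finite) edge_data"
  assumes valid: "valid_data M" and feas: "(d, c) \<in> Omega2 M s lam"
  shows "\<exists>c'. (d, c') \<in> Omega2 M s lam' \<and> H_cost M c' = H_cost M c + adjustment_cost M lam lam'"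
proof -
  obtain s1 s0 where s: "s = (s1, s0)" by (cases s)
  define c' where "c' = c\<lparr>work0 := \<lambda>i t. work0 c i t + \<bar>lam' i t - lam i t\<bar>,
    buy_more0 := \<lambda>t. buy_more0 c t + req_res M * (\<Sum>i\<in>UNIV. \<bar>lam' i t - lam i t\<bar>)\<rparr>"
  have w: "req_res M \<ge> 0" using valid by (simp add: valid_data_def)
  have demand: "lam' i t \<le> work0 c i t + \<bar>lam' i t - lam i t\<bar> + (\<Sum>j\<in>UNIV. work c i j t)"
    if "lam i t \<le> work0 c i t + (\<Sum>j\<in>UNIV. work c i j t)" for i t
    using that by linarith
  have "(d, c') \<in> Omega2 M s lam'"
    using feas w
    by (auto simp: Omega2_def s c'_def sum.distrib distrib_left demand sum_nonneg)
  moreover have "H_cost M c' = H_cost M c + adjustment_cost M lam lam'"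
    by (simp add: H_cost_def c'_def adjustment_cost_def sum.distrib sum_subtractf algebra_simps)
  ultimately show ?thesis by blast
qed

section \<open>Attainment of the recourse optimum by compactness\<close>

type_synonym ('i, 'j) recourse_tuple =
  "('i \<Rightarrow> 'j \<Rightarrow> nat \<Rightarrow> real) \<times> ('i \<Rightarrow> nat \<Rightarrow> real) \<times> ('j \<Rightarrow> nat \<Rightarrow> real) \<times> (nat \<Rightarrow> real) \<times>
   ('j \<Rightarrow> nat \<Rightarrow> real) \<times> (nat \<Rightarrow> real)"

text \<open>Records carry no topology, whereas nested tuples of functions have the product topology
  in which compactness and continuity are argued.\<close>

definition recourse_of :: "('i, 'j) recourse_tuple \<Rightarrow> ('i, 'j) recourse" where
  "recourse_of p = \<lparr>work = fst p, work0 = fst (snd p), buy_more = fst (snd (snd p)),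
     buy_more0 = fst (snd (snd (snd p))), sell_back = fst (snd (snd (snd (snd p)))),
     sell_back0 = snd (snd (snd (snd (snd p))))\<rparr>"

lemma continuous_on_apply2:
  "continuous_on A f \<Longrightarrow> continuous_on A (\<lambda>x. f x i j)"
  by (rule continuous_on_product_then_coordinatewise[OF continuous_on_product_then_coordinatewise])

lemma continuous_on_apply3:
  "continuous_on A f \<Longrightarrow> continuous_on A (\<lambda>x. f x i j k)"
  by (rule continuous_on_product_then_coordinatewise[OF continuous_on_apply2])

lemma continuous_recourse_of:
  "continuous_on A (\<lambda>p. work (recourse_of p) i j t)"
  "continuous_on A (\<lambda>p. work0 (recourse_of p) i t)"
  "continuous_on A (\<lambda>p. buy_more (recourse_of p) j t)"
  "continuous_on A (\<lambda>p. buy_more0 (recourse_of p) t)"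
  "continuous_on A (\<lambda>p. sell_back (recourse_of p) j t)"
  "continuous_on A (\<lambda>p. sell_back0 (recourse_of p) t)"
  unfolding recourse_of_def recourse.simps
       apply (rule continuous_on_apply3, intro continuous_intros)
      apply (rule continuous_on_apply2, intro continuous_intros)
     apply (rule continuous_on_apply2, intro continuous_intros)
    apply (rule continuous_on_product_then_coordinatewise, intro continuous_intros)
   apply (rule continuous_on_apply2, intro continuous_intros)
  apply (rule continuous_on_product_then_coordinatewise, intro continuous_intros)
  done

lemma closed_Collect_Ball:
  assumes "\<And>t. t \<in> A \<Longrightarrow> closed {p. P t p}"
  shows "closed {p. \<forall>t\<in>A. P t p}"
proof -
  have "{p. \<forall>t\<in>A. P t p} = (\<Inter>t\<in>A. {p. P t p})" by blast
  then show ?thesis using assms by (simp add: closed_INT)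
qed

lemma closed_Omega2_recourse:
  fixes M :: "('i::finite, 'j::finite) edge_data"
  shows "closed {p. (d, recourse_of p) \<in> Omega2 M s lam}"
proof -
  obtain s1 s0 where s: "s = (s1, s0)" by (cases s)
  show ?thesis
    unfolding Omega2_def s
    apply simp
    by (intro closed_Collect_conj closed_Collect_const closed_Collect_Ball closed_Collect_all
          closed_Collect_le continuous_recourse_of continuous_intros)
qed

text \<open>Tychonoff's theorem, as function types carry the product topology. The index type may be
  infinite, so all of \<open>nat\<close> can serve as the set of times.\<close>

lemma compact_Pi_fun:
  fixes K :: "'a \<Rightarrow> 'b::topological_space set"
  assumes "\<And>x. compact (K x)"
  shows "compact {f. \<forall>x. f x \<in> K x}"
proof -
  have "{f. \<forall>x. f x \<in> K x} = PiE UNIV K" by auto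
  then show ?thesis
    using assms compactin_PiE[of "\<lambda>_. euclidean" UNIV K]
    by (simp add: euclidean_product_topology)
qed

text \<open>The bounds apply at all times, also outside the horizon, where demands and reservations
  are arbitrary; \<open>max 0\<close> keeps 0 admissible there.\<close>

definition recourse_box ::
  "('i::finite, 'j::finite) edge_data \<Rightarrow> 'j first_stage \<Rightarrow> 'i demand \<Rightarrow> ('i, 'j) recourse_tuple set"
  where
  "recourse_box M s lam =
     {f. \<forall>i. f i \<in> {f. \<forall>j. f j \<in> {f. \<forall>t. f t \<in> {0..max 0 (lam i t)}}}} \<times>
     {f. \<forall>i. f i \<in> {f. \<forall>t. f t \<in> {0..max 0 (lam i t)}}} \<times>
     {f. \<forall>j. f j \<in> {f. \<forall>t::nat. f t \<in> {0..capacity M j}}} \<times>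
     {f. \<forall>t. f t \<in> {0..req_res M * (\<Sum>i\<in>UNIV. max 0 (lam i t))}} \<times>
     {f. \<forall>j. f j \<in> {f. \<forall>t. f t \<in> {0..max 0 (fst s j t)}}} \<times>
     {f. \<forall>t. f t \<in> {0..max 0 (snd s t)}}"

lemma compact_recourse_box: "compact (recourse_box M s lam)"
  unfolding recourse_box_def by (intro compact_Times compact_Pi_fun compact_Icc)

text \<open>Either nothing is cut off, or a single term that is cut off already contributes
  \<open>max 0 l\<close>.\<close>

lemma truncated_sum_ge:
  fixes x :: "'j::finite \<Rightarrow> real"
  assumes "x0 \<ge> 0" "\<And>j. x j \<ge> 0" "x0 + (\<Sum>j\<in>UNIV. x j) \<ge> l"
  shows "min x0 (max 0 l) + (\<Sum>j\<in>UNIV. min (x j) (max 0 l)) \<ge> l"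
proof (cases "x0 \<le> max 0 l \<and> (\<forall>j. x j \<le> max 0 l)")
  case True
  then show ?thesis using assms by (simp add: min_def)
next
  case False
  have nn: "(\<Sum>j\<in>UNIV. min (x j) (max 0 l)) \<ge> 0" using assms by (intro sum_nonneg) auto
  show ?thesis
  proof (cases "x0 \<le> max 0 l")
    case True
    with False obtain k where k: "x k > max 0 l" by (meson not_le)
    have "min (x k) (max 0 l) \<le> (\<Sum>j\<in>UNIV. min (x j) (max 0 l))"
      using assms by (intro member_le_sum) auto
    with k assms(1) show ?thesis by linarith
  next
    case False
    with nn show ?thesis by linarith
  qed
qed

text \<open>As costs are nonnegative except for the rewards of the bounded sell-backs, workloads beyond
  the demand and cloud purchases beyond the total demand only add cost.\<close>

lemma Omega2_truncate:
  fixes M :: "('i::finite, 'j::finite) edge_data"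
  assumes valid: "valid_data M" and feas: "(d, c) \<in> Omega2 M s lam"
  shows "\<exists>p\<in>recourse_box M s lam. (d, recourse_of p) \<in> Omega2 M s lam \<and>
           H_cost M (recourse_of p) \<le> H_cost M c"
proof -
  obtain s1 s0 where s: "s = (s1, s0)" by (cases s)
  let ?T = "{1..horizon M}"
  let ?w = "req_res M"
  define L where "L i t = max 0 (lam i t)" for i t
  define p :: "('i, 'j) recourse_tuple" where
    "p = ((\<lambda>i j t. if t \<in> ?T then min (work c i j t) (L i t) else 0),
       (\<lambda>i t. if t \<in> ?T then min (work0 c i t) (L i t) else 0),
       (\<lambda>j t. if t \<in> ?T then buy_more c j t else 0),
       (\<lambda>t. if t \<in> ?T then min (buy_more0 c t) (?w * (\<Sum>i\<in>UNIV. L i t)) else 0),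
       (\<lambda>j t. if t \<in> ?T then sell_back c j t else 0),
       (\<lambda>t. if t \<in> ?T then sell_back0 c t else 0))"
  have w: "?w \<ge> 0" and cap: "\<And>j. capacity M j \<ge> 0"
    using valid by (auto simp: valid_data_def)
  have L: "L i t \<ge> 0" for i t by (simp add: L_def)
  have wL: "?w * (\<Sum>i\<in>UNIV. L i t) \<ge> 0" for t by (simp add: w L sum_nonneg)
  note F = feas[unfolded Omega2_def s prod.case mem_Collect_eq]
  have dXi: "d \<in> Xi M" using F by (rule conjunct1)
  note Ft = bspec[OF conjunct2[OF F]]
  have pos: "work0 c i t \<ge> 0" "work c i j t \<ge> 0" "buy_more0 c t \<ge> 0" "sell_back0 c t \<ge> 0"
      "buy_more c j t \<ge> 0" "sell_back c j t \<ge> 0"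
    and dem: "work0 c i t + (\<Sum>j\<in>UNIV. work c i j t) \<ge> lam i t"
    and capc: "s1 j t + buy_more c j t - sell_back c j t \<le> capacity M j * place d j t"
    and sellc: "sell_back c j t \<le> s1 j t" "sell_back0 c t \<le> s0 t"
    and res0: "s0 t + buy_more0 c t - sell_back0 c t \<ge> ?w * (\<Sum>i\<in>UNIV. work0 c i t)"
    and res: "s1 j t + buy_more c j t - sell_back c j t \<ge> ?w * (\<Sum>i\<in>UNIV. work c i j t)"
    if "t \<in> ?T" for i j t
    using Ft[OF that] by simp_all
  have flow: "(\<Sum>j\<in>UNIV - {m}. dl d m j t) \<le> prev_place M d m t"
    "(\<Sum>m'\<in>UNIV - {m}. dl d m' m t) + dl0 d m t \<ge> place d m t - prev_place M d m t"
    if "t \<in> ?T" for m t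
    using Ft[OF that] by simp_all
  \<comment> \<open>The reservation left after selling back is nonnegative, so the capacity
    constraint bounds the purchase alone.\<close>
  have "buy_more c j t \<le> capacity M j" if "t \<in> ?T" for j t
  proof -
    have "place d j t = 0 \<or> place d j t = 1" using dXi by (auto simp: Xi_def)
    then have "capacity M j * place d j t \<le> capacity M j" using cap by auto
    then show ?thesis using capc[OF that, of j] sellc(1)[OF that, of j] by linarith
  qed
  then have box: "p \<in> recourse_box M s lam"
    using pos sellc cap L wL
    by (simp add: recourse_box_def p_def s L_def[symmetric] le_max_iff_disj)
  have dem': "min (work0 c i t) (L i t) + (\<Sum>j\<in>UNIV. min (work c i j t) (L i t)) \<ge> lam i t"
    if "t \<in> ?T" for i t
    unfolding L_def using pos[OF that] dem[OF that] by (intro truncated_sum_ge)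
  have res': "s1 j t + buy_more c j t - sell_back c j t \<ge> ?w * (\<Sum>i\<in>UNIV. min (work c i j t) (L i t))"
    if "t \<in> ?T" for j t
  proof -
    have "?w * (\<Sum>i\<in>UNIV. min (work c i j t) (L i t)) \<le> ?w * (\<Sum>i\<in>UNIV. work c i j t)"
      using w by (intro mult_left_mono sum_mono) auto
    then show ?thesis using res[OF that, of j] by linarith
  qed
  \<comment> \<open>If the purchase is not cut, the original constraint applies; if it is cut, it
    pays for the full truncated workload, and \<open>s0 t - sell_back0 c t\<close> is
    nonnegative.\<close>
  have res0': "s0 t + min (buy_more0 c t) (?w * (\<Sum>i\<in>UNIV. L i t)) - sell_back0 c t
      \<ge> ?w * (\<Sum>i\<in>UNIV. min (work0 c i t) (L i t))"
    if "t \<in> ?T" for t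
  proof -
    have "?w * (\<Sum>i\<in>UNIV. min (work0 c i t) (L i t)) \<le> ?w * (\<Sum>i\<in>UNIV. work0 c i t)"
      "?w * (\<Sum>i\<in>UNIV. min (work0 c i t) (L i t)) \<le> ?w * (\<Sum>i\<in>UNIV. L i t)"
      using w by (auto intro!: mult_left_mono sum_mono)
    then show ?thesis using res0[OF that] sellc(2)[OF that] by linarith
  qed
  have "(d, recourse_of p) \<in> Omega2 M s lam"
    unfolding Omega2_def s recourse_of_def p_def prod.case mem_Collect_eq
  proof (intro conjI ballI, rule dXi)
  qed (simp_all add: pos capc sellc dem' res' res0' flow L wL)
  moreover have "H_cost M (recourse_of p) \<le> H_cost M c"
  proof -
    have slot: "slot M > 0" using valid by (simp add: valid_data_def)
    have buy: "buy0 M t \<ge> 0" if "t \<in> ?T" for t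
    proof -
      have "buy0 M t \<ge> resv0 M t \<and> resv0 M t \<ge> sell0 M t \<and> sell0 M t \<ge> 0"
        using valid that unfolding valid_data_def by blast
      then show ?thesis by linarith
    qed
    show ?thesis
      unfolding H_cost_def recourse_of_def p_def
      by (intro add_mono sum_mono)
        (simp_all add: mult_left_mono slot buy work_cost_nonneg[OF valid] work_cost0_nonneg[OF valid])
  qed
  ultimately show ?thesis using box by blast
qed

text \<open>A minimum over the compact feasible part of the box is global, since every plan is
  matched there by a truncated one that costs no more.\<close>

lemma recourse_min_exists:
  fixes M :: "('i::finite, 'j::finite) edge_data"
  assumes valid: "valid_data M" and feas: "(d, c0) \<in> Omega2 M s lam"
  shows "\<exists>c. (d, c) \<in> Omega2 M s lam \<and> (\<forall>c'. (d, c') \<in> Omega2 M s lam \<longrightarrow> H_cost M c \<le> H_cost M c')"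
proof -
  let ?K = "recourse_box M s lam \<inter> {p. (d, recourse_of p) \<in> Omega2 M s lam}"
  have "compact ?K" by (intro compact_Int_closed compact_recourse_box closed_Omega2_recourse)
  moreover have "?K \<noteq> {}" using Omega2_truncate[OF valid feas] by blast
  moreover have "continuous_on ?K (\<lambda>p. H_cost M (recourse_of p))"
    unfolding H_cost_def by (intro continuous_intros continuous_recourse_of)
  ultimately obtain p where p: "p \<in> ?K"
    "\<forall>p'\<in>?K. H_cost M (recourse_of p) \<le> H_cost M (recourse_of p')"
    using continuous_attains_inf[of ?K "\<lambda>p. H_cost M (recourse_of p)"] by blast
  have "H_cost M (recourse_of p) \<le> H_cost M c'" if c': "(d, c') \<in> Omega2 M s lam" for c'
  proof -
    obtain p' where p': "p' \<in> ?K" "H_cost M (recourse_of p') \<le> H_cost M c'"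
      using Omega2_truncate[OF valid c'] by blast
    show ?thesis using bspec[OF p(2) p'(1)] p'(2) by (rule order_trans)
  qed
  then show ?thesis using p(1) by blast
qed


section \<open>The recourse value as a function of the demand\<close>

lemma recourse_value_attained:
  fixes M :: "('i::finite, 'j::finite) edge_data"
  assumes "valid_data M" and "(d, c0) \<in> Omega2 M s lam"
  shows "\<exists>c. (d, c) \<in> Omega2 M s lam \<and> recourse_value M s d lam = ereal (H_cost M c)"
proof -
  obtain c where c: "(d, c) \<in> Omega2 M s lam"
    "\<And>c'. (d, c') \<in> Omega2 M s lam \<Longrightarrow> H_cost M c \<le> H_cost M c'"
    using recourse_min_exists[OF assms] by blast
  have "recourse_value M s d lam = ereal (H_cost M c)"
    unfolding recourse_value_def
    by (rule antisym) (auto intro!: INF_lower INF_greatest c)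
  then show ?thesis using c(1) by blast
qed

lemma recourse_value_le:
  "(d, c) \<in> Omega2 M s lam \<Longrightarrow> recourse_value M s d lam \<le> ereal (H_cost M c)"
  unfolding recourse_value_def by (rule INF_lower) simp

text \<open>Turns a lower bound for the subproblem at \<open>lam\<close> into a feasible point
  \<open>(lam, v)\<close> of the master problem. Placements without feasible recourse satisfy it
  because their value is infinite.\<close>

lemma ereal_le_recourse_value:
  assumes "\<And>p. p \<in> Omega2 M s lam \<Longrightarrow> v \<le> F_cost M p"
  shows "ereal v \<le> ereal (G_cost M d) + recourse_value M s d lam"
proof -
  have "ereal (v - G_cost M d) \<le> recourse_value M s d lam"
    unfolding recourse_value_def
  proof (rule INF_greatest, clarify)
    fix c assume "(d, c) \<in> Omega2 M s lam"
    then show "ereal (v - G_cost M d) \<le> ereal (H_cost M c)"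
      using assms[of "(d, c)"] by (simp add: F_cost_def algebra_simps)
  qed
  then show ?thesis
    by (cases "recourse_value M s d lam") (auto simp: algebra_simps)
qed

text \<open>Feasibility at one scenario carries over to all of them through the cloud. Adjusting an
  optimal plan for \<open>lam\<close> to \<open>lam'\<close> gives the Lipschitz-type
  estimate.\<close>

lemma recourse_value_real:
  fixes M :: "('i::finite, 'j::finite) edge_data"
  assumes valid: "valid_data M" and feas: "(d, c0) \<in> Omega2 M s lam0"
  shows "\<exists>V. (\<forall>lam. recourse_value M s d lam = ereal (V lam)) \<and>
             (\<forall>lam lam'. V lam' \<le> V lam + adjustment_cost M lam lam')"
proof -
  have "\<exists>c. (d, c) \<in> Omega2 M s lam \<and> recourse_value M s d lam = ereal (H_cost M c)" for lam
    using Omega2_adjust[OF valid feas, of lam] recourse_value_attained[OF valid] by blast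
  then obtain c where c: "\<And>lam. (d, c lam) \<in> Omega2 M s lam"
    "\<And>lam. recourse_value M s d lam = ereal (H_cost M (c lam))"
    by metis
  have "H_cost M (c lam') \<le> H_cost M (c lam) + adjustment_cost M lam lam'" for lam lam'
  proof -
    obtain c' where c': "(d, c') \<in> Omega2 M s lam'"
      "H_cost M c' = H_cost M (c lam) + adjustment_cost M lam lam'"
      using Omega2_adjust[OF valid c(1)] by blast
    show ?thesis using recourse_value_le[OF c'(1)] c(2)[of lam'] c'(2) by simp
  qed
  with c(2) show ?thesis by (intro exI[of _ "\<lambda>lam. H_cost M (c lam)"]) blast
qed

text \<open>By symmetry \<open>adjustment_cost\<close> bounds the absolute difference of values. It
  involves only finitely many coordinates, so it tends to 0 in the product topology.\<close>

lemma continuous_adjustment_bounded: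
  fixes M :: "('i::finite, 'j::finite) edge_data" and V :: "'i demand \<Rightarrow> real"
  assumes "\<And>lam lam'. V lam' \<le> V lam + adjustment_cost M lam lam'"
  shows "continuous_on A V"
proof -
  have "(V \<longlongrightarrow> V lam) (at lam within A)" for lam
  proof -
    have "continuous_on UNIV (\<lambda>lam'. adjustment_cost M lam lam')"
      unfolding adjustment_cost_def
      by (intro continuous_intros continuous_on_apply2)
    then have "((\<lambda>lam'. adjustment_cost M lam lam') \<longlongrightarrow> adjustment_cost M lam lam) (at lam)"
      by (simp add: continuous_on_def)
    then have "((\<lambda>lam'. adjustment_cost M lam lam') \<longlongrightarrow> 0) (at lam within A)"
      using tendsto_within_subset[of _ _ lam UNIV A] by (simp add: adjustment_cost_eq_0)
    then have "((\<lambda>lam'. V lam' - V lam) \<longlongrightarrow> 0) (at lam within A)"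
    proof (rule Lim_null_comparison[rotated], intro always_eventually allI)
      show "norm (V lam' - V lam) \<le> adjustment_cost M lam lam'" for lam'
        using assms[of lam' lam] assms[of lam lam'] by (simp add: adjustment_cost_commute[of M lam'])
    qed
    then show ?thesis by (rule LIM_zero_cancel)
  qed
  then show ?thesis by (simp add: continuous_on_def)
qed

section \<open>Placements and the inner subproblem\<close>

lemma finite_Xi: "finite (Xi (M :: ('i, 'j::finite) edge_data))"
proof -
  \<comment> \<open>Binary functions supported on the finite set \<open>A\<close>; the three
    components of a placement are uncurried into such functions.\<close>
  let ?fs = "\<lambda>A. {f :: _ \<Rightarrow> real. \<forall>x. (x \<in> A \<longrightarrow> f x \<in> {0, 1}) \<and> (x \<notin> A \<longrightarrow> f x = 0)}"
  let ?Q = "?fs (UNIV \<times> UNIV \<times> {1..horizon M}) :: ('j \<times> 'j \<times> nat \<Rightarrow> real) set"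
  let ?Z = "?fs (UNIV \<times> {1..horizon M}) :: ('j \<times> nat \<Rightarrow> real) set"
  let ?mk = "\<lambda>(q, q0, z). \<lparr>dl = \<lambda>m j t. q (m, j, t), dl0 = \<lambda>j t. q0 (j, t), place = \<lambda>j t. z (j, t)\<rparr>"
  have "finite ?Q" "finite ?Z"
    by (intro finite_set_of_finite_funs; simp)+
  then have "finite (?mk ` (?Q \<times> ?Z \<times> ?Z))" by (intro finite_imageI finite_cartesian_product)
  moreover have "Xi M \<subseteq> ?mk ` (?Q \<times> ?Z \<times> ?Z)"
  proof
    fix d assume "d \<in> Xi M"
    then have d: "dl d m j t \<in> {0, 1}" "dl0 d j t \<in> {0, 1}" "place d j t \<in> {0, 1}"
      "t \<notin> {1..horizon M} \<Longrightarrow> dl d m j t = 0 \<and> dl0 d j t = 0 \<and> place d j t = 0" for m j t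
      by (simp_all add: Xi_def)
    show "d \<in> ?mk ` (?Q \<times> ?Z \<times> ?Z)"
    proof (rule image_eqI)
      show "d = ?mk (\<lambda>(m, j, t). dl d m j t, \<lambda>(j, t). dl0 d j t, \<lambda>(j, t). place d j t)" by simp
      show "(\<lambda>(m, j, t). dl d m j t, \<lambda>(j, t). dl0 d j t, \<lambda>(j, t). place d j t) \<in> ?Q \<times> ?Z \<times> ?Z"
        using d by auto
    qed
  qed
  ultimately show ?thesis by (rule finite_subset[rotated])
qed

text \<open>Serves twice: it admits recourse at every demand, and it is one half of the pair of
  twins.\<close>

definition no_placement :: "'j placement" where
  "no_placement = \<lparr>dl = \<lambda>_ _ _. 0, dl0 = \<lambda>_ _. 0, place = \<lambda>_ _. 0\<rparr>"

lemma no_placement_simps [simp]: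
  "dl no_placement m j t = 0" "dl0 no_placement j t = 0" "place no_placement j t = 0"
  by (simp_all add: no_placement_def)

lemma no_placement_in_Xi: "no_placement \<in> Xi M"
  by (simp add: Xi_def)

lemma prev_place_no_placement_nonneg:
  assumes "valid_data M"
  shows "0 \<le> prev_place M no_placement j t"
proof -
  have "init_place M j = 0 \<or> init_place M j = 1" using assms by (simp add: valid_data_def)
  then show ?thesis by (auto simp: prev_place_def)
qed

text \<open>All demand goes to the cloud. Without placements the capacity constraint leaves no edge
  resources, so every edge reservation is sold back.\<close>

lemma Omega2_nonempty:
  fixes M :: "('i::finite, 'j::finite) edge_data"
  assumes valid: "valid_data M" and s: "s \<in> Omega1 M"
  shows "\<exists>c. (no_placement, c) \<in> Omega2 M s lam"
proof -
  obtain s1 s0 where s': "s = (s1, s0)" by (cases s)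
  have s1: "s0 t \<ge> 0" "s1 j t \<ge> 0" if "t \<in> {1..horizon M}" for j t
    using s that by (auto simp: Omega1_def s')
  have w: "req_res M \<ge> 0" using valid by (simp add: valid_data_def)
  let ?c = "\<lparr>work = \<lambda>_ _ _. 0, work0 = \<lambda>i t. max 0 (lam i t), buy_more = \<lambda>_ _. 0,
     buy_more0 = \<lambda>t. req_res M * (\<Sum>i\<in>UNIV. max 0 (lam i t)), sell_back = s1, sell_back0 = \<lambda>_. 0\<rparr>"
  have "(no_placement, ?c) \<in> Omega2 M s lam"
    unfolding Omega2_def s' prod.case mem_Collect_eq
  proof (intro conjI ballI, rule no_placement_in_Xi)
  qed (simp_all add: s1 w sum_nonneg prev_place_no_placement_nonneg[OF valid])
  then show ?thesis by blast
qed

lemma inner_SP_optimal_iff: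
  "inner_SP_optimal M s lam p \<longleftrightarrow>
     p \<in> Omega2 M s lam \<and> (\<forall>p'\<in>Omega2 M s lam. F_cost M p \<le> F_cost M p')"
  by (auto simp: inner_SP_optimal_def is_arg_min_def not_less)

lemma Omega2_placement: "(d, c) \<in> Omega2 M s lam \<Longrightarrow> d \<in> Xi M"
  by (cases s) (simp add: Omega2_def)

text \<open>Finitely many placements admit recourse; each has an optimal plan, and the cheapest of
  these pairs is optimal.\<close>

lemma inner_SP_exists:
  fixes M :: "('i::finite, 'j::finite) edge_data"
  assumes valid: "valid_data M" and s: "s \<in> Omega1 M"
  shows "\<exists>p. inner_SP_optimal M s lam p"
proof -
  let ?D = "{d. \<exists>c. (d, c) \<in> Omega2 M s lam}"
  have "?D \<subseteq> Xi M" using Omega2_placement by blast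
  then have fin: "finite ?D" using finite_Xi by (rule finite_subset)
  have ne: "?D \<noteq> {}" using Omega2_nonempty[OF valid s] by blast
  have "\<forall>d\<in>?D. \<exists>c. (d, c) \<in> Omega2 M s lam \<and>
      (\<forall>c'. (d, c') \<in> Omega2 M s lam \<longrightarrow> H_cost M c \<le> H_cost M c')"
    using recourse_min_exists[OF valid] by blast
  from bchoice[OF this] obtain c where c: "\<forall>d\<in>?D. (d, c d) \<in> Omega2 M s lam \<and>
      (\<forall>c'. (d, c') \<in> Omega2 M s lam \<longrightarrow> H_cost M (c d) \<le> H_cost M c')"
    ..
  obtain d where d: "is_arg_min (\<lambda>d. F_cost M (d, c d)) (\<lambda>d. d \<in> ?D) d"
    using ex_is_arg_min_if_finite[OF fin ne, of "\<lambda>d. F_cost M (d, c d)"] ..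
  have "F_cost M (d, c d) \<le> F_cost M (d', c')" if "(d', c') \<in> Omega2 M s lam" for d' c'
  proof -
    have d': "d' \<in> ?D" using that by blast
    have "F_cost M (d, c d) \<le> F_cost M (d', c d')"
      using d d' unfolding is_arg_min_def by (meson not_less)
    also have "\<dots> \<le> F_cost M (d', c')"
      using c d' that by (simp add: F_cost_def)
    finally show ?thesis .
  qed
  moreover have "d \<in> ?D" using d by (simp add: is_arg_min_def)
  then have "(d, c d) \<in> Omega2 M s lam" using c by blast
  ultimately show ?thesis by (intro exI[of _ "(d, c d)"]) (auto simp: inner_SP_optimal_iff)
qed

section \<open>Scenarios and the inner master problem\<close>

text \<open>Solves the recursion hidden in \<open>D2\<close> forward in time, making residuals an
  explicit function of the noise. Lags start at 1, so stage \<open>Suc n\<close> reads only times up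
  to \<open>n\<close>; the value 0 at later times is a placeholder.\<close>

primrec resid_upto ::
  "('i, 'j) edge_data \<Rightarrow> ('i \<Rightarrow> nat \<Rightarrow> real) \<Rightarrow> nat \<Rightarrow> 'i \<Rightarrow> int \<Rightarrow> real" where
  "resid_upto M g 0 = (\<lambda>i t. if t \<le> 0 then past_resid M i t else 0)"
| "resid_upto M g (Suc n) = (\<lambda>i t. if t = int (Suc n)
     then (\<Sum>s=1..lag M. ar_coeff M i s * resid_upto M g n i (t - int s)) + ar_noise M i * g i (Suc n)
     else resid_upto M g n i t)"

lemma resid_upto_stable:
  assumes "n \<le> m" "t \<le> int n"
  shows "resid_upto M g m i t = resid_upto M g n i t"
  using assms by (induction m rule: dec_induct) auto

lemma resid_upto_rec:
  assumes "t \<in> {1..n}"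
  shows "resid_upto M g n i (int t) =
    (\<Sum>s=1..lag M. ar_coeff M i s * resid_upto M g n i (int t - int s)) + ar_noise M i * g i t"
proof -
  obtain k where k: "t = Suc k" using assms by (cases t) auto
  have "resid_upto M g n i (int t) = resid_upto M g t i (int t)"
    using assms by (intro resid_upto_stable) auto
  also have "\<dots> = (\<Sum>s=1..lag M. ar_coeff M i s * resid_upto M g k i (int t - int s)) + ar_noise M i * g i t"
    by (simp add: k)
  also have "(\<Sum>s=1..lag M. ar_coeff M i s * resid_upto M g k i (int t - int s)) =
      (\<Sum>s=1..lag M. ar_coeff M i s * resid_upto M g n i (int t - int s))"
  proof (rule sum.cong)
    fix s assume "s \<in> {1..lag M}"
    then have "resid_upto M g n i (int t - int s) = resid_upto M g k i (int t - int s)"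
      using assms k by (intro resid_upto_stable) auto
    then show "ar_coeff M i s * resid_upto M g k i (int t - int s) =
        ar_coeff M i s * resid_upto M g n i (int t - int s)" by simp
  qed simp
  finally show ?thesis .
qed

text \<open>Agreement is limited to times up to \<open>n\<close> because \<open>D2\<close> leaves
  residuals beyond the horizon unconstrained.\<close>

lemma resid_upto_unique:
  assumes "\<And>t. t \<le> 0 \<Longrightarrow> resid i t = past_resid M i t"
    and "\<And>t. t \<in> {1..n} \<Longrightarrow> resid i (int t) =
      (\<Sum>s=1..lag M. ar_coeff M i s * resid i (int t - int s)) + ar_noise M i * g i t"
    and "t \<le> int n"
  shows "resid i t = resid_upto M g n i t"
  using assms(2,3)
proof (induction n arbitrary: t)
  case 0
  then show ?case using assms(1) by simp
next
  case (Suc n)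
  show ?case
  proof (cases "t = int (Suc n)")
    case True
    have "(\<Sum>s=1..lag M. ar_coeff M i s * resid i (int (Suc n) - int s)) =
        (\<Sum>s=1..lag M. ar_coeff M i s * resid_upto M g n i (int (Suc n) - int s))"
      by (rule sum.cong) (auto intro!: Suc.IH Suc.prems(1))
    then show ?thesis using Suc.prems(1)[of "Suc n"] True by simp
  next
    case False
    then show ?thesis using Suc.IH[of t] Suc.prems by simp
  qed
qed

lemma continuous_resid_upto: "continuous_on A (\<lambda>g. resid_upto M g n i t)"
proof (induction n arbitrary: t)
  case 0
  then show ?case by simp
next
  case (Suc n)
  show ?case
  proof (cases "t = int (Suc n)")
    case True
    have "continuous_on A (\<lambda>g. (\<Sum>s=1..lag M. ar_coeff M i s * resid_upto M g n i (t - int s)) +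
        ar_noise M i * g i (Suc n))"
      by (intro continuous_intros Suc.IH continuous_on_apply2)
    then show ?thesis using True by simp
  next
    case False
    then show ?thesis using Suc.IH by simp
  qed
qed

text \<open>\<^const>\<open>D2\<close> itself is not compact since it leaves the demands at times outside
  \<open>1, \<dots>, T\<close> arbitrary.\<close>

lemma D2_compact_representatives:
  fixes M :: "('i::finite, 'j) edge_data"
  shows "\<exists>K. compact K \<and> K \<subseteq> D2 M \<and>
    (\<forall>lam\<in>D2 M. \<exists>lam'\<in>K. \<forall>i. \<forall>t\<in>{1..horizon M}. lam i t = lam' i t)"
proof -
  let ?T = "{1..horizon M}"
  \<comment> \<open>Noise is confined to \<open>{-1..1}\<close> at all times, not only in the
    horizon, to make \<open>N\<close> compact; the representatives are its continuous image under
    \<open>S\<close>.\<close>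
  define N :: "('i \<Rightarrow> nat \<Rightarrow> real) set" where
    "N = {g. \<forall>i. g i \<in> {f. \<forall>t. f t \<in> {-1..1}}} \<inter>
         {g. \<forall>t\<in>?T. (\<Sum>i\<in>UNIV. \<bar>g i t\<bar>) \<le> real_of_int (budget M)}"
  define S where "S g i t = (if t \<in> ?T then forecast M i t + resid_upto M g (horizon M) i (int t) else 0)"
    for g i t
  have "compact N"
    unfolding N_def
    by (intro compact_Int_closed compact_Pi_fun compact_Icc closed_Collect_Ball closed_Collect_le
        continuous_intros continuous_on_apply2)
  moreover have "continuous_on N S"
  proof (intro continuous_on_coordinatewise_then_product)
    show "continuous_on N (\<lambda>g. S g i t)" for i t
      by (cases "t \<in> ?T") (auto simp: S_def intro!: continuous_intros continuous_resid_upto)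
  qed
  ultimately have comp: "compact (S ` N)" by (intro compact_continuous_image)
  have sub: "S g \<in> D2 M" if "g \<in> N" for g
    unfolding D2_def mem_Collect_eq
  proof (intro exI conjI allI ballI impI)
    show "resid_upto M g (horizon M) i t = past_resid M i t" if "t \<le> 0" for i t
      using that resid_upto_stable[of 0 "horizon M" t M g i] by simp
    show "resid_upto M g (horizon M) i (int t) = (\<Sum>s=1..lag M. ar_coeff M i s *
        resid_upto M g (horizon M) i (int t - int s)) + ar_noise M i * g i t" if "t \<in> ?T" for i t
      using that by (rule resid_upto_rec)
    show "g i t \<in> {-1..1}" for i t using \<open>g \<in> N\<close> by (auto simp: N_def)
    show "(\<Sum>i\<in>UNIV. \<bar>g i t\<bar>) \<le> real_of_int (budget M)" if "t \<in> ?T" for t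
      using \<open>g \<in> N\<close> that unfolding N_def by blast
    show "S g i t = forecast M i t + resid_upto M g (horizon M) i (int t)" if "t \<in> ?T" for i t
      using that by (simp add: S_def)
  qed
  have repr: "\<exists>lam'\<in>S ` N. \<forall>i. \<forall>t\<in>?T. lam i t = lam' i t" if lam: "lam \<in> D2 M" for lam
  proof -
    obtain g resid where past: "\<forall>i. \<forall>t\<le>0. resid i t = past_resid M i t"
      and g: "\<forall>t\<in>?T. (\<forall>i. g i t \<in> {-1..1}) \<and> (\<Sum>i\<in>UNIV. \<bar>g i t\<bar>) \<le> real_of_int (budget M)"
      and res: "\<forall>i. \<forall>t\<in>?T. lam i t = forecast M i t + resid i (int t) \<and>
        resid i (int t) =
          (\<Sum>s=1..lag M. ar_coeff M i s * resid i (int t - int s)) + ar_noise M i * g i t"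
      using lam unfolding D2_def mem_Collect_eq by blast
    \<comment> \<open>Outside the horizon the given noise may be unbounded, so it is reset to 0 to
      lie in \<open>N\<close>.\<close>
    define g' where "g' i t = (if t \<in> ?T then g i t else 0)" for i t
    have "g' \<in> N" using g by (auto simp: N_def g'_def)
    moreover have "resid i (int t) = resid_upto M g' (horizon M) i (int t)" if "t \<in> ?T" for i t
    proof (rule resid_upto_unique)
      show "resid i t = past_resid M i t" if "t \<le> 0" for t using past that by blast
      show "resid i (int t) = (\<Sum>s=1..lag M. ar_coeff M i s * resid i (int t - int s)) +
          ar_noise M i * g' i t" if "t \<in> ?T" for t
        using res that by (simp add: g'_def)
    qed (use that in simp)
    then have "\<forall>i. \<forall>t\<in>?T. lam i t = S g' i t"
      using res by (simp add: S_def)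
    ultimately show ?thesis by (intro bexI[of _ "S g'"] imageI)
  qed
  show ?thesis
    by (intro exI[of _ "S ` N"] conjI ballI image_subsetI comp sub repr)
qed

section \<open>Existence of an optimum of the inner master problem\<close>

lemma inner_MP_optimal_iff:
  "inner_MP_optimal M s ds (lam, tau) \<longleftrightarrow> (lam, tau) \<in> inner_MP_feasible M s ds \<and>
     (\<forall>lam' tau'. (lam', tau') \<in> inner_MP_feasible M s ds \<longrightarrow> tau' \<le> tau)"
  by (auto simp: inner_MP_optimal_def is_arg_max_def not_less)

lemma continuous_on_Min:
  fixes f :: "'d \<Rightarrow> 'a::topological_space \<Rightarrow> 'b::linorder_topology"
  assumes "finite D" "D \<noteq> {}" "\<And>d. d \<in> D \<Longrightarrow> continuous_on A (f d)"
  shows "continuous_on A (\<lambda>x. Min ((\<lambda>d. f d x) ` D))"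
  using assms by (induction D rule: finite_ne_induct) (auto intro!: continuous_on_min)

lemma inner_MP_exists:
  fixes M :: "('i::finite, 'j::finite) edge_data"
  assumes valid: "valid_data M" and ne: "ds \<noteq> []" "D2 M \<noteq> {}"
    and feas: "\<And>d. d \<in> set ds \<Longrightarrow> \<exists>lam c. (d, c) \<in> Omega2 M s lam"
  shows "\<exists>lam tau. inner_MP_optimal M s ds (lam, tau)"
proof -
  have "\<forall>d\<in>set ds. \<exists>V. (\<forall>lam. recourse_value M s d lam = ereal (V lam)) \<and>
      (\<forall>lam lam'. V lam' \<le> V lam + adjustment_cost M lam lam')"
    using feas recourse_value_real[OF valid] by blast
  from bchoice[OF this] obtain V where "\<forall>d\<in>set ds.
      (\<forall>lam. recourse_value M s d lam = ereal (V d lam)) \<and>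
      (\<forall>lam lam'. V d lam' \<le> V d lam + adjustment_cost M lam lam')"
    ..
  then have V: "recourse_value M s d lam = ereal (V d lam)"
    and V_le: "V d lam' \<le> V d lam + adjustment_cost M lam lam'"
    if "d \<in> set ds" for d lam lam'
    using that by blast+
  \<comment> \<open>The largest \<open>tau\<close> admissible at \<open>lam\<close>. Maximising over
    pairs thus becomes maximising a continuous function over \<open>K\<close>.\<close>
  define phi where "phi lam = Min ((\<lambda>d. G_cost M d + V d lam) ` set ds)" for lam
  have le_phi: "(\<forall>d\<in>set ds. ereal tau \<le> ereal (G_cost M d) + recourse_value M s d lam) \<longleftrightarrow>
      tau \<le> phi lam" for tau lam
    using ne(1) by (simp add: phi_def V)
  from D2_compact_representatives[of M] obtain K where "compact K \<and> K \<subseteq> D2 M \<and>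
    (\<forall>lam\<in>D2 M. \<exists>lam'\<in>K. \<forall>i. \<forall>t\<in>{1..horizon M}. lam i t = lam' i t)"
    ..
  then have K: "compact K" "K \<subseteq> D2 M"
    "\<And>lam. lam \<in> D2 M \<Longrightarrow> \<exists>lam'\<in>K. \<forall>i. \<forall>t\<in>{1..horizon M}. lam i t = lam' i t"
    by simp_all
  have "K \<noteq> {}" using K(3) ne(2) by blast
  moreover have "continuous_on K (V d)" if "d \<in> set ds" for d
    by (rule continuous_adjustment_bounded) (rule V_le[OF that])
  then have "continuous_on K phi"
    unfolding phi_def using ne(1) by (intro continuous_on_Min continuous_intros) auto
  ultimately obtain lam where lam: "lam \<in> K" "\<forall>lam'\<in>K. phi lam' \<le> phi lam"
    using continuous_attains_sup[OF K(1)] by blast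
  have "phi lam' \<le> phi lam" if lam': "lam' \<in> D2 M" for lam'
  proof -
    obtain l where l: "l \<in> K" "\<forall>i. \<forall>t\<in>{1..horizon M}. lam' i t = l i t"
      using K(3)[OF lam'] ..
    \<comment> \<open>Demands that agree on the horizon have zero adjustment cost, hence equal
      \<open>phi\<close>; the maximum over \<open>K\<close> is therefore one over
      \<open>D2 M\<close>.\<close>
    then have "adjustment_cost M lam' l = 0" by (intro adjustment_cost_eq_0) simp
    then have "adjustment_cost M l lam' = 0" "adjustment_cost M lam' l = 0"
      using adjustment_cost_commute[of M] by simp_all
    note adj = this
    have "V d lam' = V d l" if "d \<in> set ds" for d
      using V_le[OF that, of l lam'] V_le[OF that, of lam' l] adj by simp
    then have "phi lam' = phi l" by (simp add: phi_def cong: image_cong_simp)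
    then show ?thesis using lam(2) l(1) by simp
  qed
  then have "inner_MP_optimal M s ds (lam, phi lam)"
    using lam(1) K(2)
    by (auto simp: inner_MP_optimal_iff inner_MP_feasible_def le_phi intro: order_trans)
  then show ?thesis by (intro exI)
qed

section \<open>Convergence\<close>

text \<open>Twins cannot both be found without closing the gap, see \<open>inner_step_invariant\<close>.\<close>

definition twins ::
  "('i::finite, 'j::finite) edge_data \<Rightarrow> 'j first_stage \<Rightarrow> 'j placement \<Rightarrow> 'j placement \<Rightarrow> bool" where
  "twins M s d d' \<longleftrightarrow> (\<forall>lam c. (d, c) \<in> Omega2 M s lam \<longleftrightarrow> (d', c) \<in> Omega2 M s lam)"

definition twin_free ::
  "('i::finite, 'j::finite) edge_data \<Rightarrow> 'j first_stage \<Rightarrow> 'j placement list \<Rightarrow> bool" where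
  "twin_free M s ds \<longleftrightarrow> distinct ds \<and> (\<forall>d\<in>set ds. \<forall>d'\<in>set ds. twins M s d d' \<longrightarrow> d = d')"

lemma twins_sym: "twins M s d d' \<longleftrightarrow> twins M s d' d"
  unfolding twins_def by metis

lemma twin_free_snoc:
  assumes "twin_free M s ds" and "\<And>d'. d' \<in> set ds \<Longrightarrow> \<not> twins M s d d'"
  shows "twin_free M s (ds @ [d])"
proof -
  \<comment> \<open>\<open>twins\<close> is reflexive, so excluding twins also excludes
    repetition.\<close>
  have "d \<notin> set ds" using assms(2)[of d] by (auto simp: twins_def)
  moreover have "\<not> twins M s d' d" if "d' \<in> set ds" for d'
    using assms(2)[OF that] twins_sym[of M s d d'] by simp
  ultimately show ?thesis using assms by (auto simp: twin_free_def)
qed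

text \<open>Downloading from the cloud without placing anything only costs money.\<close>

lemma twins_exist:
  fixes M :: "('i::finite, 'j::finite) edge_data"
  assumes valid: "valid_data M" and T: "horizon M \<noteq> 0"
  shows "\<exists>d\<in>Xi M. d \<noteq> no_placement \<and> twins M s no_placement d"
proof -
  define j0 :: 'j where "j0 = undefined"
  \<comment> \<open>One cloud download in slot 1, which lies in the horizon. \<open>dl0\<close>
    enters the constraints only on the larger side of an inequality that the empty placement already
    satisfies. Twins may differ in placement cost.\<close>
  define d where "d = no_placement\<lparr>dl0 := \<lambda>j t. if j = j0 \<and> t = 1 then 1 else 0\<rparr>"
  have d_simps: "dl d m j t = 0" "place d j t = 0" "dl0 d j t = (if j = j0 \<and> t = 1 then 1 else 0)"
    for m j t by (simp_all add: d_def)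
  have "d \<in> Xi M" using T by (auto simp: Xi_def d_simps)
  moreover have "dl0 d j0 1 \<noteq> dl0 no_placement j0 1" by (simp add: d_simps)
  then have "d \<noteq> no_placement" by metis
  moreover have "twins M s no_placement d"
  proof -
    obtain s1 s0 where s: "s = (s1, s0)" by (cases s)
    have prev: "prev_place M d j t = prev_place M no_placement j t" for j t
      by (simp add: prev_place_def d_simps)
    have "- prev_place M no_placement j t \<le> 0" "- prev_place M no_placement j t \<le> 1" for j t
      using prev_place_no_placement_nonneg[OF valid, of j t] by linarith+
    then have "(d, c) \<in> Omega2 M s lam \<longleftrightarrow> (no_placement, c) \<in> Omega2 M s lam" for c lam
      unfolding Omega2_def s prod.case mem_Collect_eq
      using \<open>d \<in> Xi M\<close> no_placement_in_Xi[of M] by (simp add: d_simps prev)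
    then show ?thesis by (simp add: twins_def)
  qed
  ultimately show ?thesis by blast
qed

text \<open>\<open>Xi M\<close> itself contains twins, so a twin-free list omits a placement. The
  strict inequality pays for the last iteration.\<close>

lemma twin_free_length_less:
  fixes M :: "('i::finite, 'j::finite) edge_data"
  assumes "valid_data M" "horizon M \<noteq> 0" and tf: "twin_free M s ds" and sub: "set ds \<subseteq> Xi M"
  shows "length ds < card (Xi M)"
proof -
  obtain d where d: "d \<in> Xi M" "d \<noteq> no_placement" "twins M s no_placement d"
    using twins_exist[OF assms(1,2)] by blast
  have "set ds \<noteq> Xi M"
    using d no_placement_in_Xi[of M] tf unfolding twin_free_def by blast
  then have "card (set ds) < card (Xi M)"
    using sub by (intro psubset_card_mono finite_Xi) blast
  then show ?thesis using tf by (simp add: twin_free_def distinct_card)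
qed

text \<open>Constraints of the master problem only accumulate, so the clause on feasible
  \<open>tau\<close> keeps \<open>UB\<close> from increasing. The clause on \<open>LB\<close> keeps
  it below the next \<open>tau\<close>. Optimality of each found placement at some scenario serves
  to compare the costs of twins. The last clause is conditional because the iteration that closes
  the gap may add a twin.\<close>

definition inner_invariant ::
  "('i::finite, 'j::finite) edge_data \<Rightarrow> 'j first_stage \<Rightarrow> ('i, 'j) inner_state \<Rightarrow> bool" where
  "inner_invariant M s S \<longleftrightarrow>
     scen S \<in> D2 M \<and>
     (\<forall>d\<in>set (found S). UB S \<le> ereal (G_cost M d) + recourse_value M s d (scen S) \<and>
        (\<exists>lam c. inner_SP_optimal M s lam (d, c))) \<and>
     (\<forall>lam tau. (lam, tau) \<in> inner_MP_feasible M s (found S) \<longrightarrow> ereal tau \<le> UB S) \<and>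
     (LB S = -\<infinity> \<or> (\<exists>lam\<in>D2 M. \<exists>v. LB S = ereal v \<and> (\<forall>p\<in>Omega2 M s lam. v \<le> F_cost M p))) \<and>
     (UB S \<noteq> LB S \<longrightarrow> twin_free M s (found S))"

lemma inner_invariant_init:
  "lam0 \<in> D2 M \<Longrightarrow> inner_invariant M s (inner_init lam0)"
  by (simp add: inner_invariant_def inner_init_def twin_free_def)

lemma found_in_Xi:
  assumes "inner_invariant M s S"
  shows "set (found S) \<subseteq> Xi M"
proof
  fix d assume "d \<in> set (found S)"
  then obtain lam c where "inner_SP_optimal M s lam (d, c)"
    using assms unfolding inner_invariant_def by blast
  then have "(d, c) \<in> Omega2 M s lam" by (simp add: inner_SP_optimal_iff)
  then show "d \<in> Xi M" by (rule Omega2_placement)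
qed

lemma inner_step_invariant:
  fixes M :: "('i::finite, 'j::finite) edge_data"
  assumes inv: "inner_invariant M s S" and step: "inner_step M s S S'"
  shows "inner_invariant M s S'" and "LB S' \<le> UB S'"
proof -
  obtain d c lam tau where ne: "UB S \<noteq> LB S"
    and SP: "inner_SP_optimal M s (scen S) (d, c)"
    and MP: "inner_MP_optimal M s (found S @ [d]) (lam, tau)"
    and S': "S' = \<lparr>LB = max (LB S) (ereal (F_cost M (d, c))), UB = ereal tau,
               scen = lam, found = found S @ [d]\<rparr>"
    using step unfolding inner_step_def by blast
  have inv_scen: "scen S \<in> D2 M"
    and inv_found: "\<And>d. d \<in> set (found S) \<Longrightarrow>
       UB S \<le> ereal (G_cost M d) + recourse_value M s d (scen S)"
    and inv_opt: "\<And>d. d \<in> set (found S) \<Longrightarrow> \<exists>lam c. inner_SP_optimal M s lam (d, c)"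
    and inv_UB: "\<And>lam tau. (lam, tau) \<in> inner_MP_feasible M s (found S) \<Longrightarrow> ereal tau \<le> UB S"
    and inv_LB: "LB S = -\<infinity> \<or>
       (\<exists>lam\<in>D2 M. \<exists>v. LB S = ereal v \<and> (\<forall>p\<in>Omega2 M s lam. v \<le> F_cost M p))"
    and inv_twins: "twin_free M s (found S)"
    using inv ne unfolding inner_invariant_def by simp_all
  have feas: "(lam, tau) \<in> inner_MP_feasible M s (found S @ [d])"
    and opt: "\<And>lam' tau'. (lam', tau') \<in> inner_MP_feasible M s (found S @ [d]) \<Longrightarrow> tau' \<le> tau"
    using MP by (simp_all add: inner_MP_optimal_iff)
  have SP_feas: "(d, c) \<in> Omega2 M s (scen S)"
    and SP_opt: "\<And>p. p \<in> Omega2 M s (scen S) \<Longrightarrow> F_cost M (d, c) \<le> F_cost M p"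
    using SP by (simp_all add: inner_SP_optimal_iff)
  \<comment> \<open>The source of \<open>LB S' \<le> UB S'\<close>: a lower bound for the subproblem
    at any scenario is itself a feasible value of \<open>tau\<close>.\<close>
  have lower: "v \<le> tau" if "lam' \<in> D2 M" "\<And>p. p \<in> Omega2 M s lam' \<Longrightarrow> v \<le> F_cost M p" for v lam'
  proof (rule opt)
    show "(lam', v) \<in> inner_MP_feasible M s (found S @ [d])"
      using that by (simp add: inner_MP_feasible_def ereal_le_recourse_value)
  qed
  have F_le: "F_cost M (d, c) \<le> tau" using inv_scen SP_opt by (rule lower)
  moreover have "LB S \<le> ereal tau"
    using inv_LB
  proof
    assume "\<exists>lam\<in>D2 M. \<exists>v. LB S = ereal v \<and> (\<forall>p\<in>Omega2 M s lam. v \<le> F_cost M p)"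
    then obtain lam' v where "lam' \<in> D2 M" "LB S = ereal v" "\<forall>p\<in>Omega2 M s lam'. v \<le> F_cost M p"
      by blast
    then show ?thesis using lower[of lam' v] by simp
  qed simp
  ultimately show LB_UB: "LB S' \<le> UB S'" by (simp add: S')
  \<comment> \<open>\<open>UB\<close> is limited by the constraint of the earlier twin
    \<open>d'\<close> at the current scenario. The plan \<open>c\<close> is feasible with
    \<open>d'\<close> too, and \<open>d'\<close> costs no more than \<open>d\<close>, so this limit
    is at most the new \<open>LB\<close>.\<close>
  have closed: "UB S' = LB S'" if d': "d' \<in> set (found S)" and tw: "twins M s d d'" for d'
  proof -
    have "UB S' \<le> UB S"
      using feas by (auto simp: S' inner_MP_feasible_def intro!: inv_UB)
    also have "\<dots> \<le> ereal (G_cost M d') + recourse_value M s d' (scen S)"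
      using d' by (rule inv_found)
    also have "\<dots> \<le> ereal (G_cost M d') + ereal (H_cost M c)"
    proof (intro add_left_mono recourse_value_le)
      show "(d', c) \<in> Omega2 M s (scen S)" using tw SP_feas by (simp add: twins_def)
    qed
    also have "\<dots> \<le> ereal (F_cost M (d, c))"
    proof -
      \<comment> \<open>At the scenario where \<open>d'\<close> was optimal, its twin
        \<open>d\<close> was available with the same plan; cancelling \<open>H_cost M c'\<close>
        leaves the comparison of placement costs.\<close>
      obtain l' c' where "inner_SP_optimal M s l' (d', c')" using inv_opt[OF d'] by blast
      then have "F_cost M (d', c') \<le> F_cost M (d, c')"
        using tw by (simp add: inner_SP_optimal_iff twins_def)
      then show ?thesis by (simp add: F_cost_def)
    qed
    also have "\<dots> \<le> LB S'" by (simp add: S')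
    finally show ?thesis using LB_UB by (rule antisym)
  qed
  show "inner_invariant M s S'"
    unfolding inner_invariant_def
  proof (intro conjI ballI allI impI)
    show "scen S' \<in> D2 M" using feas by (simp add: S' inner_MP_feasible_def)
    show "UB S' \<le> ereal (G_cost M d') + recourse_value M s d' (scen S')"
      if "d' \<in> set (found S')" for d'
      using feas that by (auto simp: S' inner_MP_feasible_def)
    show "\<exists>lam c. inner_SP_optimal M s lam (d', c)" if "d' \<in> set (found S')" for d'
      using that inv_opt[of d'] SP unfolding S' by auto
    show "ereal tau' \<le> UB S'" if "(lam', tau') \<in> inner_MP_feasible M s (found S')" for lam' tau'
      using opt[of lam' tau'] that by (simp add: S')
    show "LB S' = -\<infinity> \<or>
        (\<exists>lam\<in>D2 M. \<exists>v. LB S' = ereal v \<and> (\<forall>p\<in>Omega2 M s lam. v \<le> F_cost M p))"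
    proof (cases "LB S \<le> ereal (F_cost M (d, c))")
      case True
      then have "LB S' = ereal (F_cost M (d, c))" by (simp add: S')
      then show ?thesis using inv_scen SP_opt by blast
    next
      case False
      then have "LB S' = LB S" by (simp add: S')
      then show ?thesis using inv_LB by simp
    qed
    show "twin_free M s (found S')" if "UB S' \<noteq> LB S'"
    proof -
      have "\<not> twins M s d d'" if "d' \<in> set (found S)" for d'
        using closed[OF that] \<open>UB S' \<noteq> LB S'\<close> by blast
      then show ?thesis using twin_free_snoc[OF inv_twins] by (simp add: S')
    qed
  qed
qed

text \<open>Without time slots \<open>Omega2\<close> does not depend on the demand, so the
  subproblem's plan stays feasible at the new scenario and its cost bounds the new
  \<open>UB\<close>.\<close>

lemma inner_step_no_horizon:
  fixes M :: "('i::finite, 'j::finite) edge_data"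
  assumes T: "horizon M = 0" and inv: "inner_invariant M s S" and step: "inner_step M s S S'"
  shows "UB S' = LB S'"
proof -
  obtain d c lam tau where SP: "inner_SP_optimal M s (scen S) (d, c)"
    and MP: "inner_MP_optimal M s (found S @ [d]) (lam, tau)"
    and S': "S' = \<lparr>LB = max (LB S) (ereal (F_cost M (d, c))), UB = ereal tau,
               scen = lam, found = found S @ [d]\<rparr>"
    using step unfolding inner_step_def by blast
  have "(d, c) \<in> Omega2 M s lam"
    using SP T by (cases s) (simp add: inner_SP_optimal_iff Omega2_def)
  have "UB S' \<le> ereal (G_cost M d) + recourse_value M s d lam"
    using MP by (simp add: S' inner_MP_optimal_iff inner_MP_feasible_def)
  also have "\<dots> \<le> ereal (G_cost M d) + ereal (H_cost M c)"
    by (intro add_left_mono recourse_value_le) fact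
  also have "\<dots> \<le> LB S'" by (simp add: S' F_cost_def)
  finally show ?thesis using inner_step_invariant(2)[OF inv step] by (rule antisym)
qed

lemma inner_reachable_invariant:
  fixes M :: "('i::finite, 'j::finite) edge_data"
  assumes "lam0 \<in> D2 M" and "(inner_step M s ^^ n) (inner_init lam0) S"
  shows "inner_invariant M s S \<and> length (found S) = n"
  using assms(2)
proof (induction n arbitrary: S)
  case 0
  then have "S = inner_init lam0" by simp
  then show ?case using inner_invariant_init[OF assms(1)] by (simp add: inner_init_def)
next
  case (Suc n)
  then obtain S0 where S0: "(inner_step M s ^^ n) (inner_init lam0) S0" "inner_step M s S0 S"
    by (auto elim: relpowp_Suc_E)
  have "length (found S) = Suc (length (found S0))"
    using S0(2) by (auto simp: inner_step_def)
  then show ?case using Suc.IH[OF S0(1)] inner_step_invariant(1)[OF _ S0(2)] by simp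
qed

text \<open>The last iteration starts with an open gap, so the \<open>n - 1\<close> placements found
  before it are twin-free and fewer than \<open>card (Xi M)\<close>. For an empty horizon there are
  no distinct twins, but the first iteration already closes the gap.\<close>

lemma inner_iterations_le:
  fixes M :: "('i::finite, 'j::finite) edge_data"
  assumes valid: "valid_data M" and lam0: "lam0 \<in> D2 M"
    and reach: "(inner_step M s ^^ n) (inner_init lam0) S"
  shows "n \<le> card (Xi M)"
proof (cases n)
  case (Suc k)
  then obtain S0 where S0: "(inner_step M s ^^ k) (inner_init lam0) S0" "inner_step M s S0 S"
    using reach by (auto elim: relpowp_Suc_E)
  then have ne: "UB S0 \<noteq> LB S0" by (simp add: inner_step_def)
  have inv: "inner_invariant M s S0" and len: "length (found S0) = k"
    using inner_reachable_invariant[OF lam0 S0(1)] by simp_all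
  show ?thesis
  proof (cases "horizon M = 0")
    case False
    have "twin_free M s (found S0)" using inv ne by (simp add: inner_invariant_def)
    then have "length (found S0) < card (Xi M)"
      using twin_free_length_less[OF valid False] found_in_Xi[OF inv] by blast
    then show ?thesis using len Suc by simp
  next
    case True
    have "k = 0"
    proof (rule ccontr)
      assume "k \<noteq> 0"
      then obtain k' where "k = Suc k'" by (cases k) auto
      then obtain S1 where S1: "(inner_step M s ^^ k') (inner_init lam0) S1" "inner_step M s S1 S0"
        using S0(1) by (auto elim: relpowp_Suc_E)
      then show False
        using inner_step_no_horizon[OF True _ S1(2)] inner_reachable_invariant[OF lam0 S1(1)] ne
        by simp
    qed
    moreover have "card (Xi M) > 0"
      using finite_Xi[of M] no_placement_in_Xi[of M] by (auto simp: card_gt_0_iff)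
    ultimately show ?thesis using Suc by simp
  qed
qed simp

lemma inner_step_exists:
  fixes M :: "('i::finite, 'j::finite) edge_data"
  assumes valid: "valid_data M" and s: "s \<in> Omega1 M" and inv: "inner_invariant M s S"
    and ne: "UB S \<noteq> LB S"
  shows "\<exists>S'. inner_step M s S S'"
proof -
  obtain d c where SP: "inner_SP_optimal M s (scen S) (d, c)"
    using inner_SP_exists[OF valid s, of "scen S"] by auto
  have "D2 M \<noteq> {}" using inv by (auto simp: inner_invariant_def)
  moreover have "\<exists>lam c. (d', c) \<in> Omega2 M s lam" if d': "d' \<in> set (found S @ [d])" for d'
  proof -
    have "\<exists>lam c. inner_SP_optimal M s lam (d', c)"
      using d' SP inv unfolding inner_invariant_def by auto
    then show ?thesis by (auto simp: inner_SP_optimal_iff)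
  qed
  ultimately obtain lam tau where "inner_MP_optimal M s (found S @ [d]) (lam, tau)"
    using inner_MP_exists[OF valid, of "found S @ [d]" s] by auto
  with SP ne show ?thesis unfolding inner_step_def by blast
qed

text \<open>The two parts together give finite convergence: no run can be prolonged past the bound,
  and a run that cannot be prolonged has a closed gap, whichever optimal solutions were
  chosen.\<close>

theorem mainTheorem1:
  fixes M :: "('i::finite, 'j::finite) edge_data"
    and s :: "'j first_stage" and lam0 :: "'i demand"
  assumes "valid_data M" and "s \<in> Omega1 M" and "lam0 \<in> D2 M"
  shows "(\<forall>n S. (inner_step M s ^^ n) (inner_init lam0) S \<longrightarrow> n \<le> card (Xi M)) \<and>
         (\<forall>n S. (inner_step M s ^^ n) (inner_init lam0) S \<longrightarrow>
            UB S = LB S \<or> (\<exists>S'. inner_step M s S S'))"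
proof (intro conjI allI impI)
  fix n S assume reach: "(inner_step M s ^^ n) (inner_init lam0) S"
  show "n \<le> card (Xi M)" using assms(1,3) reach by (rule inner_iterations_le)
  show "UB S = LB S \<or> (\<exists>S'. inner_step M s S S')"
    using inner_step_exists[OF assms(1,2)] inner_reachable_invariant[OF assms(3) reach] by blast
qed

end
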